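(* Let $G$ be a connected graph. Then $\mathrm{vv}(G)$ is equal to the largest possible number of leaves of a shortest-path tree of $G$, where the maximum is taken over all shortest-path trees of $G$ rooted at any vertex of $G$.
   Context: All graphs are finite and simple. For a vertex $x$ of a connected graph $G$, a set $S\subseteq V(G)\setminus\{x\}$ is an $x$-visibility set if for every $y\in S$ there exists a shortest $x,y$-path $P$ in $G$ with $V(P)\cap S=\{y\}$. The $x$-visibility number $v_x(G)$ is the maximum cardinality of an $x$-visibility set, and $\mathrm{vv}(G)=\max_{x\in V(G)} v_x(G)$. A shortest-path tree of $G$ rooted at $x\in V(G)$ is a spanning tree $T$ of $G$ such that $d_T(x,y)=d_G(x,y)$ for every $y\in V(G)$ (e.g. a BFS tree from $x$); its leaves are the non-root vertices of $T$ having no children, i.e. non-root vertices of degree $1$ in $T$. *)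

theory Defs
  imports Main
begin

record 'a ugraph =
  verts :: "'a set"
  edges :: "'a set set"

definition simple_graph :: "'a ugraph \<Rightarrow> bool" where
  "simple_graph G \<longleftrightarrow>
     finite (verts G) \<and> (\<forall>e \<in> edges G. e \<subseteq> verts G \<and> card e = 2)"

text \<open>A path is given by the nonempty list of its vertices; its length (number of edges) is
  one less than the length of this list.\<close>

definition path_between :: "'a ugraph \<Rightarrow> 'a \<Rightarrow> 'a \<Rightarrow> 'a list \<Rightarrow> bool" where
  "path_between G x y p \<longleftrightarrow>
     p \<noteq> [] \<and> hd p = x \<and> last p = y \<and> set p \<subseteq> verts G \<and> distinct p \<and>
     successively (\<lambda>u v. {u, v} \<in> edges G) p"

definition path_length :: "'a list \<Rightarrow> nat" where
  "path_length p = length p - 1"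

text \<open>The null graph is not connected.\<close>

definition connected_graph :: "'a ugraph \<Rightarrow> bool" where
  "connected_graph G \<longleftrightarrow>
     verts G \<noteq> {} \<and> (\<forall>x \<in> verts G. \<forall>y \<in> verts G. \<exists>p. path_between G x y p)"

text \<open>Meaningful only if \<open>x\<close> and \<open>y\<close> lie in the same component.\<close>

definition gdist :: "'a ugraph \<Rightarrow> 'a \<Rightarrow> 'a \<Rightarrow> nat" where
  "gdist G x y = (LEAST n. \<exists>p. path_between G x y p \<and> path_length p = n)"

definition shortest_path :: "'a ugraph \<Rightarrow> 'a \<Rightarrow> 'a \<Rightarrow> 'a list \<Rightarrow> bool" where
  "shortest_path G x y p \<longleftrightarrow> path_between G x y p \<and> path_length p = gdist G x y"

definition visibility_set :: "'a ugraph \<Rightarrow> 'a \<Rightarrow> 'a set \<Rightarrow> bool" where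
  "visibility_set G x S \<longleftrightarrow>
     S \<subseteq> verts G - {x} \<and> (\<forall>y \<in> S. \<exists>p. shortest_path G x y p \<and> set p \<inter> S = {y})"

definition visibility_number :: "'a ugraph \<Rightarrow> 'a \<Rightarrow> nat" where
  "visibility_number G x = Max {card S | S. visibility_set G x S}"

definition vv :: "'a ugraph \<Rightarrow> nat" where
  "vv G = Max {visibility_number G x | x. x \<in> verts G}"

text \<open>A cycle is listed by its vertices without repeating the first one at the end.\<close>

definition is_cycle :: "'a ugraph \<Rightarrow> 'a list \<Rightarrow> bool" where
  "is_cycle G c \<longleftrightarrow>
     length c \<ge> 3 \<and> set c \<subseteq> verts G \<and> distinct c \<and>
     successively (\<lambda>u v. {u, v} \<in> edges G) c \<and> {last c, hd c} \<in> edges G"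

definition is_tree :: "'a ugraph \<Rightarrow> bool" where
  "is_tree T \<longleftrightarrow> simple_graph T \<and> connected_graph T \<and> (\<nexists>c. is_cycle T c)"

definition spanning_tree :: "'a ugraph \<Rightarrow> 'a ugraph \<Rightarrow> bool" where
  "spanning_tree G T \<longleftrightarrow> is_tree T \<and> verts T = verts G \<and> edges T \<subseteq> edges G"

definition shortest_path_tree :: "'a ugraph \<Rightarrow> 'a \<Rightarrow> 'a ugraph \<Rightarrow> bool" where
  "shortest_path_tree G x T \<longleftrightarrow>
     x \<in> verts G \<and> spanning_tree G T \<and> (\<forall>y \<in> verts G. gdist T x y = gdist G x y)"

definition degree :: "'a ugraph \<Rightarrow> 'a \<Rightarrow> nat" where
  "degree G v = card {e \<in> edges G. v \<in> e}"

text \<open>The root \<open>x\<close> is never a leaf, even if it has degree 1 in \<open>T\<close>.\<close>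

definition leaves :: "'a ugraph \<Rightarrow> 'a \<Rightarrow> 'a set" where
  "leaves T x = {y \<in> verts T - {x}. degree T y = 1}"

text \<open>The maxima in the definitions of \<^const>\<open>visibility_number\<close> and \<^const>\<open>vv\<close> are over
  finite nonempty sets.\<close>

lemma finite_visibility_cards:
  assumes "simple_graph G"
  shows "finite {card S | S. visibility_set G x S}"
proof -
  have "{card S | S. visibility_set G x S} \<subseteq> card ` Pow (verts G)"
    by (auto simp: visibility_set_def)
  moreover have "finite (card ` Pow (verts G))"
    using assms by (simp add: simple_graph_def)
  ultimately show ?thesis
    by (rule finite_subset)
qed

lemma visibility_cards_nonempty: "{card S | S. visibility_set G x S} \<noteq> {}"
proof -
  have "visibility_set G x {}"
    by (simp add: visibility_set_def)
  then show ?thesis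
    by blast
qed

lemma finite_visibility_numbers:
  assumes "simple_graph G"
  shows "finite {visibility_number G x | x. x \<in> verts G}"
  using assms by (simp add: simple_graph_def)

lemma visibility_numbers_nonempty:
  assumes "connected_graph G"
  shows "{visibility_number G x | x. x \<in> verts G} \<noteq> {}"
  using assms by (auto simp: connected_graph_def)

lemma finite_leaf_counts:
  assumes "simple_graph G"
  shows "finite {card (leaves T x) | T x. shortest_path_tree G x T}"
proof -
  have "{card (leaves T x) | T x. shortest_path_tree G x T} \<subseteq> card ` Pow (verts G)"
    by (auto simp: shortest_path_tree_def spanning_tree_def leaves_def)
  moreover have "finite (card ` Pow (verts G))"
    using assms by (simp add: simple_graph_def)
  ultimately show ?thesis
    by (rule finite_subset)
qed

end

theory Submission
  imports Defs
begin

text \<open>The leaves of a shortest-path tree rooted at \<open>x\<close> form an \<open>x\<close>-visibility set, because inner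
  vertices of tree paths have degree at least two. Conversely, let \<open>S\<close> be an \<open>x\<close>-visibility set and
  let \<open>D\<close> be the set of vertices reached from \<open>x\<close> by a shortest path avoiding \<open>S\<close>. Every non-root
  vertex of \<open>D \<union> S\<close> has a neighbour in \<open>D\<close> one step closer to \<open>x\<close>. Choosing such neighbours as
  parents yields a shortest-path tree in which no vertex of \<open>S\<close> is an ancestor of another one. The
  subtrees below the vertices of \<open>S\<close> are then disjoint, and each of them contains a leaf.\<close>

section \<open>Paths and distances\<close>

lemma path_between_snocD:
  assumes "path_between G x y p" "y \<noteq> x"
  obtains q where "p = q @ [y]" "path_between G x (last q) q" "{last q, y} \<in> edges G"
    "y \<notin> set q" "y \<in> verts G"
proof -
  from assms have "p \<noteq> []" "last p = y"
    by (auto simp: path_between_def)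
  then obtain q where p: "p = q @ [y]"
    by (metis append_butlast_last_id)
  with assms have "q \<noteq> []"
    by (auto simp: path_between_def)
  with assms p show thesis
    by (intro that[of q]) (auto simp: path_between_def successively_append_iff)
qed

text \<open>Either \<open>z\<close> is appended to \<open>p\<close>, or \<open>z\<close> already
  occurs on \<open>p\<close> and the path is cut off there; the second case is why only an
  inequality holds.\<close>

lemma path_between_step:
  assumes p: "path_between G x y p" and e: "{y, z} \<in> edges G" and z: "z \<in> verts G"
  obtains p' where "path_between G x z p'" "path_length p' \<le> Suc (path_length p)"
proof (cases "z \<in> set p")
  case True
  then obtain q r where "p = q @ z # r"
    by (meson split_list)
  with p show thesis
    by (intro that[of "q @ [z]"])
      (auto simp: path_between_def path_length_def successively_append_iff hd_append
            split: if_splits)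
next
  case False
  with p e z show thesis
    by (intro that[of "p @ [z]"])
      (auto simp: path_between_def path_length_def successively_append_iff)
qed

lemma gdist_le: "path_between G x y p \<Longrightarrow> gdist G x y \<le> path_length p"
  unfolding gdist_def by (rule Least_le) blast

lemma ex_shortest_path:
  assumes "path_between G x y p"
  obtains q where "shortest_path G x y q"
proof -
  have "\<exists>n p. path_between G x y p \<and> path_length p = n"
    using assms by blast
  then have "\<exists>p. path_between G x y p \<and> path_length p = gdist G x y"
    unfolding gdist_def by (rule LeastI_ex)
  then show thesis
    using that by (auto simp: shortest_path_def)
qed

lemma path_between_self: "x \<in> verts G \<Longrightarrow> path_between G x x [x]"
  by (simp add: path_between_def)

lemma gdist_self: "x \<in> verts G \<Longrightarrow> gdist G x x = 0"
  using gdist_le[OF path_between_self] by (simp add: path_length_def)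

lemma shortest_path_self: "x \<in> verts G \<Longrightarrow> shortest_path G x x [x]"
  by (simp add: shortest_path_def path_between_self gdist_self path_length_def)

lemma gdist_step:
  assumes "path_between G x y p" "{y, z} \<in> edges G" "z \<in> verts G"
  shows "gdist G x z \<le> Suc (gdist G x y)"
proof -
  obtain q where "shortest_path G x y q"
    using ex_shortest_path[OF assms(1)] .
  then have q: "path_between G x y q" "path_length q = gdist G x y"
    by (auto simp: shortest_path_def)
  obtain q' where "path_between G x z q'" "path_length q' \<le> Suc (path_length q)"
    using path_between_step[OF q(1) assms(2,3)] .
  then show ?thesis
    using gdist_le q(2) by fastforce
qed

text \<open>The prefix \<open>q\<close> is itself shortest:
  \<open>gdist G x y = Suc (path_length q)\<close>, while \<open>gdist_step\<close> bounds this
  distance by \<open>Suc (gdist G x (last q))\<close>, which forces equality in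
  \<open>gdist_le\<close> for \<open>q\<close>.\<close>

lemma shortest_path_snocD:
  assumes "shortest_path G x y p" "y \<noteq> x"
  obtains q where "p = q @ [y]" "shortest_path G x (last q) q" "{last q, y} \<in> edges G"
    "y \<notin> set q" "gdist G x y = Suc (gdist G x (last q))"
proof -
  from assms obtain q where q: "p = q @ [y]" "path_between G x (last q) q" "{last q, y} \<in> edges G"
    "y \<notin> set q" "y \<in> verts G"
    by (auto simp: shortest_path_def elim: path_between_snocD)
  have "gdist G x y = Suc (path_length q)"
    using assms(1) q by (cases q) (auto simp: shortest_path_def path_length_def path_between_def)
  moreover have "gdist G x y \<le> Suc (gdist G x (last q))"
    using gdist_step[OF q(2,3,5)] .
  moreover have "gdist G x (last q) \<le> path_length q"
    using gdist_le[OF q(2)] .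
  ultimately show thesis
    using q by (intro that[of q]) (auto simp: shortest_path_def)
qed

lemma path_between_mono:
  assumes "path_between T x y p" "verts T = verts G" "edges T \<subseteq> edges G"
  shows "path_between G x y p"
  using assms by (auto simp: path_between_def intro: successively_mono)

lemma connected_graphI:
  assumes "x \<in> verts G" and "\<And>y. y \<in> verts G \<Longrightarrow> \<exists>p. path_between G x y p"
  shows "connected_graph G"
proof -
  \<comment> \<open>Concatenating two paths may repeat vertices. So the second path is followed edge
    by edge, and \<open>path_between_step\<close> keeps the vertices distinct.\<close>
  have trans: "\<exists>r. path_between G a c r" if "path_between G a b p" "path_between G b c q" for a b c p q
    using that(2)
  proof (induction q arbitrary: c rule: rev_induct)
    case Nil
    then show ?case by (simp add: path_between_def)
  next
    case (snoc v q)
    show ?case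
    proof (cases "c = b")
      case True
      with that(1) show ?thesis by blast
    next
      case False
      with snoc.prems obtain q' where q': "q @ [v] = q' @ [c]" "path_between G b (last q') q'"
        "{last q', c} \<in> edges G" "c \<in> verts G"
        by (auto elim: path_between_snocD)
      with snoc.IH obtain r where "path_between G a (last q') r"
        by auto
      with q'(3,4) show ?thesis
        by (meson path_between_step)
    qed
  qed
  have "path_between G b a (rev p)" if "path_between G a b p" for a b p
    using that by (auto simp: path_between_def hd_rev last_rev insert_commute)
  with trans assms show ?thesis
    unfolding connected_graph_def by (metis empty_iff)
qed

section \<open>Leaves of shortest-path trees\<close>

lemma visibility_set_leaves:
  assumes T: "shortest_path_tree G x T"
  shows "visibility_set G x (leaves T x)"
  unfolding visibility_set_def
proof (intro conjI ballI)
  show "leaves T x \<subseteq> verts G - {x}"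
    using T by (auto simp: leaves_def shortest_path_tree_def spanning_tree_def)
next
  fix y assume y: "y \<in> leaves T x"
  from T have V: "verts T = verts G" and E: "edges T \<subseteq> edges G" and x: "x \<in> verts G"
    and conn: "connected_graph T" and dist: "\<And>y. y \<in> verts G \<Longrightarrow> gdist T x y = gdist G x y"
    by (auto simp: shortest_path_tree_def spanning_tree_def is_tree_def)
  from y V have "y \<in> verts G"
    by (simp add: leaves_def)
  with conn x V obtain p where p: "shortest_path T x y p"
    unfolding connected_graph_def by (metis ex_shortest_path)
  then have pT: "path_between T x y p"
    by (simp add: shortest_path_def)
  have "shortest_path G x y p"
    using p dist \<open>y \<in> verts G\<close> path_between_mono[OF _ V E] by (auto simp: shortest_path_def)
  moreover have "v = y" if "v \<in> set p" "v \<in> leaves T x" for v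
  proof (rule ccontr)
    assume "v \<noteq> y"
    obtain q r where qr: "p = q @ v # r"
      using \<open>v \<in> set p\<close> by (meson split_list)
    \<comment> \<open>\<open>p\<close> starts at \<open>x\<close>, which is not a leaf, and ends at
      \<open>y\<close>, so \<open>v\<close> is an inner vertex. Its single tree edge would then lead
      both to its predecessor and to its successor, although \<open>p\<close> is distinct.\<close>
    have "q \<noteq> []" "r \<noteq> []"
      using pT qr \<open>v \<noteq> y\<close> \<open>v \<in> leaves T x\<close> by (auto simp: path_between_def leaves_def)
    then have "{last q, v} \<in> {e \<in> edges T. v \<in> e}" "{v, hd r} \<in> {e \<in> edges T. v \<in> e}"
      using pT qr by (auto simp: path_between_def successively_append_iff successively_Cons)
    moreover have "card {e \<in> edges T. v \<in> e} = 1"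
      using \<open>v \<in> leaves T x\<close> by (simp add: leaves_def degree_def)
    ultimately have "{last q, v} = {v, hd r}"
      by (metis card_1_singletonE singletonD)
    moreover have "last q \<in> set q" "hd r \<in> set r"
      using \<open>q \<noteq> []\<close> \<open>r \<noteq> []\<close> by auto
    ultimately show False
      using pT qr by (auto simp: path_between_def doubleton_eq_iff)
  qed
  ultimately show "\<exists>p. shortest_path G x y p \<and> set p \<inter> leaves T x = {y}"
    using y pT by (intro exI[of _ p]) (auto simp: path_between_def)
qed

section \<open>Trees given by parent functions\<close>

lemma is_cycle_two_neighbours:
  assumes "is_cycle G c" "v \<in> set c"
  obtains u w where "u \<in> set c" "w \<in> set c" "u \<noteq> w" "{u, v} \<in> edges G" "{w, v} \<in> edges G"
proof -
  obtain q r where c: "c = q @ v # r"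
    using assms(2) by (meson split_list)
  \<comment> \<open>The cyclic predecessor and successor of \<open>v\<close>; the conditionals treat
    the closing edge between the two ends of the list. They differ because a cycle has at least
    three vertices.\<close>
  let ?u = "if q = [] then last r else last q"
  let ?w = "if r = [] then hd q else hd r"
  have len: "length q + length r \<ge> 2" and dist: "distinct (q @ r)"
    using assms(1) c by (auto simp: is_cycle_def)
  have hd_last: "hd a \<noteq> last a" if "distinct a" "length a \<ge> 2" for a :: "'a list"
    using that by (cases a) auto
  have "?u \<noteq> ?w"
  proof (cases "q = [] \<or> r = []")
    case True
    with len dist hd_last[of q] hd_last[of r] show ?thesis
      by (auto simp: eq_commute)
  next
    case False
    with dist show ?thesis
      by simp (metis disjoint_iff hd_in_set last_in_set)
  qed
  moreover have "?u \<in> set c" "?w \<in> set c"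
  proof -
    have "q \<noteq> [] \<or> r \<noteq> []"
      using len by auto
    then show "?u \<in> set c" "?w \<in> set c"
      using c by auto
  qed
  moreover have "{?u, v} \<in> edges G" "{?w, v} \<in> edges G"
    using assms(1) c len
    by (auto simp: is_cycle_def successively_append_iff successively_Cons insert_commute
               hd_append split: if_splits)
  ultimately show thesis
    using that by blast
qed

definition parent_tree :: "'a set \<Rightarrow> 'a \<Rightarrow> ('a \<Rightarrow> 'a) \<Rightarrow> 'a ugraph" where
  "parent_tree V x par = \<lparr>verts = V, edges = {{par v, v} | v. v \<in> V - {x}}\<rparr>"

text \<open>The parent maps of breadth-first search trees. The value \<open>par x\<close> stays
  arbitrary here; \<open>card_le_leaves\<close> needs the root to be a fixed point.\<close>

locale bfs_parents =
  fixes G :: "'a ugraph" and x :: 'a and par :: "'a \<Rightarrow> 'a"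
  assumes simple: "simple_graph G" and root: "x \<in> verts G"
    and par_edge: "v \<in> verts G - {x} \<Longrightarrow> {par v, v} \<in> edges G"
    and gdist_par: "v \<in> verts G - {x} \<Longrightarrow> gdist G x v = Suc (gdist G x (par v))"
begin

abbreviation "T \<equiv> parent_tree (verts G) x par"

lemma ex_farthest:
  assumes "finite A" "A \<noteq> {}"
  obtains v where "v \<in> A" "\<And>u. u \<in> A \<Longrightarrow> gdist G x u \<le> gdist G x v"
proof -
  have "Max (gdist G x ` A) \<in> gdist G x ` A"
    using assms by simp
  then obtain v where "v \<in> A" "Max (gdist G x ` A) = gdist G x v"
    by blast
  moreover have "gdist G x u \<le> Max (gdist G x ` A)" if "u \<in> A" for u
    using assms(1) that by simp
  ultimately show thesis
    using that by simp
qed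

lemma par_in_verts: "v \<in> verts G - {x} \<Longrightarrow> par v \<in> verts G"
  using par_edge simple by (fastforce simp: simple_graph_def)

lemma verts_T [simp]: "verts T = verts G"
  by (simp add: parent_tree_def)

lemma edges_T: "edges T = {{par v, v} | v. v \<in> verts G - {x}}"
  by (simp add: parent_tree_def)

lemma edges_T_subset: "edges T \<subseteq> edges G"
  using par_edge by (auto simp: edges_T)

text \<open>Induction along parents, each one step closer to the root. The path is carried along
  with the bound because \<open>gdist\<close> is meaningful only between connected vertices.\<close>

lemma ex_path_T:
  "v \<in> verts G \<Longrightarrow> \<exists>p. path_between T x v p \<and> gdist T x v \<le> gdist G x v"
proof (induction "gdist G x v" arbitrary: v rule: less_induct)
  case less
  show ?case
  proof (cases "v = x")
    case True
    then show ?thesis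
      using path_between_self[of x T] gdist_self[of x T] root by auto
  next
    case False
    with less.prems have v: "v \<in> verts G - {x}"
      by simp
    obtain p where p: "path_between T x (par v) p" "gdist T x (par v) \<le> gdist G x (par v)"
      using less.hyps[of "par v"] gdist_par[OF v] par_in_verts[OF v] by auto
    have e: "{par v, v} \<in> edges T" "v \<in> verts T"
      using v by (auto simp: edges_T)
    obtain p' where "path_between T x v p'"
      using path_between_step[OF p(1) e] .
    moreover have "gdist T x v \<le> gdist G x v"
      using gdist_step[OF p(1) e] p(2) gdist_par[OF v] by simp
    ultimately show ?thesis
      by blast
  qed
qed

lemma gdist_T:
  assumes "v \<in> verts G"
  shows "gdist T x v = gdist G x v"
proof (rule antisym)
  show "gdist T x v \<le> gdist G x v"
    using ex_path_T[OF assms] by blast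
  obtain p where "shortest_path T x v p"
    using ex_path_T[OF assms] ex_shortest_path by metis
  then show "gdist G x v \<le> gdist T x v"
    using gdist_le[OF path_between_mono[OF _ verts_T edges_T_subset]]
    by (metis shortest_path_def)
qed

text \<open>A cycle vertex farthest from the root would have its parent as both of its neighbours.\<close>

lemma acyclic_T: "\<not> is_cycle T c"
proof
  assume c: "is_cycle T c"
  then have "finite (set c)" "set c \<noteq> {}"
    by (auto simp: is_cycle_def)
  then obtain v where v: "v \<in> set c" "\<And>u. u \<in> set c \<Longrightarrow> gdist G x u \<le> gdist G x v"
    using ex_farthest by metis
  obtain u w where uw: "u \<in> set c" "w \<in> set c" "u \<noteq> w" "{u, v} \<in> edges T" "{w, v} \<in> edges T"
    using is_cycle_two_neighbours[OF c v(1)] .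
  have "u = par v" if "u \<in> set c" "{u, v} \<in> edges T" for u
  proof -
    from that(2) obtain a where a: "a \<in> verts G - {x}" "{u, v} = {par a, a}"
      by (auto simp: edges_T)
    then show ?thesis
      using gdist_par[OF a(1)] v(2)[OF that(1)] by (auto simp: doubleton_eq_iff)
  qed
  with uw show False
    by metis
qed

lemma shortest_path_tree_T: "shortest_path_tree G x T"
proof -
  have "simple_graph T"
    using simple edges_T_subset by (auto simp: simple_graph_def)
  moreover have "connected_graph T"
    using root ex_path_T by (intro connected_graphI[of x]) auto
  ultimately show ?thesis
    using acyclic_T edges_T_subset gdist_T root
    by (simp add: shortest_path_tree_def spanning_tree_def is_tree_def)
qed

text \<open>A tree edge at \<open>v\<close> joins it to its parent or to a child.\<close>

lemma childless_in_leaves: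
  assumes "v \<in> verts G - {x}" "\<And>u. u \<in> verts G - {x} \<Longrightarrow> par u \<noteq> v"
  shows "v \<in> leaves T x"
proof -
  have "{e \<in> edges T. v \<in> e} = {{par v, v}}"
    using assms by (auto simp: edges_T)
  then show ?thesis
    using assms(1) by (simp add: leaves_def degree_def)
qed

text \<open>Each vertex of \<open>S\<close> is sent to a leaf below it. This map is injective, since
  all proper ancestors of a vertex of \<open>S\<close> lie in \<open>D\<close> and hence outside
  \<open>S\<close>.\<close>

lemma card_le_leaves:
  assumes S: "S \<subseteq> verts G - {x}" and disj: "D \<inter> S = {}"
    and par_x: "par x = x" and par_D: "\<And>v. v \<in> D \<union> S \<Longrightarrow> par v \<in> D"
  shows "card S \<le> card (leaves T x)"
proof -
  have fin: "finite (verts G)"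
    using simple by (simp add: simple_graph_def)
  have "\<exists>l k. l \<in> leaves T x \<and> (par ^^ k) l = s" if s: "s \<in> S" for s
  proof -
    \<comment> \<open>The descendants of \<open>s\<close>, including \<open>s\<close> itself by
      \<open>k = 0\<close>. One farthest from the root has no child, as a child would be a farther
      descendant.\<close>
    define B where "B = {v \<in> verts G. \<exists>k. (par ^^ k) v = s}"
    have "s \<in> B"
      using s S by (auto simp: B_def intro: exI[of _ 0])
    moreover have "finite B"
      using fin by (simp add: B_def)
    ultimately obtain l where l: "l \<in> B" "\<And>u. u \<in> B \<Longrightarrow> gdist G x u \<le> gdist G x l"
      using ex_farthest by (metis empty_iff)
    obtain k where k: "(par ^^ k) l = s"
      using l(1) by (auto simp: B_def)
    \<comment> \<open>The root is fixed by \<open>par\<close>, so its iterates never reach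
      \<open>s\<close>; hence \<open>l\<close> is not the root.\<close>
    have "(par ^^ n) x = x" for n
      by (induction n) (simp_all add: par_x)
    then have "l \<noteq> x"
      using k s S by auto
    moreover have "par u \<noteq> l" if u: "u \<in> verts G - {x}" for u
    proof
      assume "par u = l"
      then have "(par ^^ Suc k) u = s"
        using k by (simp add: funpow_swap1)
      then have "u \<in> B"
        using u unfolding B_def by blast
      then show False
        using l(2)[of u] gdist_par[OF u] \<open>par u = l\<close> by simp
    qed
    ultimately have "l \<in> leaves T x"
      using l(1) by (intro childless_in_leaves) (auto simp: B_def)
    with k show ?thesis
      by blast
  qed
  then obtain f k where f: "\<And>s. s \<in> S \<Longrightarrow> f s \<in> leaves T x \<and> (par ^^ k s) (f s) = s"
    by metis
  have anc_D: "(par ^^ Suc n) s \<in> D" if "s \<in> S" for s n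
    by (induction n) (use that par_D in auto)
  \<comment> \<open>Both are ancestors of the same leaf, so the one reached after more steps is an
    ancestor of the other. Were they distinct, it would be a proper ancestor and lie in
    \<open>D\<close>.\<close>
  have aux: "s = s'" if "s \<in> S" "s' \<in> S" "f s = f s'" "k s \<le> k s'" for s s'
  proof (rule ccontr)
    assume "s \<noteq> s'"
    have "s' = (par ^^ (k s' - k s + k s)) (f s)"
      using f that by auto
    also have "\<dots> = (par ^^ (k s' - k s)) s"
      using f[OF \<open>s \<in> S\<close>] unfolding funpow_add by simp
    finally have s': "s' = (par ^^ (k s' - k s)) s" .
    then obtain n where "k s' - k s = Suc n"
      using \<open>s \<noteq> s'\<close> by (cases "k s' - k s") auto
    then have "s' \<in> D"
      using s' anc_D[OF \<open>s \<in> S\<close>] by metis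
    with disj \<open>s' \<in> S\<close> show False
      by blast
  qed
  have "inj_on f S"
    by (rule inj_onI) (metis aux nle_le)
  then show ?thesis
    using f fin by (intro card_inj_on_le[of f]) (auto simp: leaves_def)
qed

end

section \<open>From a visibility set to a tree with enough leaves\<close>

lemma ex_tree_card_le_leaves:
  assumes G: "simple_graph G" "connected_graph G" and x: "x \<in> verts G"
    and S: "visibility_set G x S"
  obtains T where "shortest_path_tree G x T" "card S \<le> card (leaves T x)"
proof -
  define D where "D = {v. \<exists>p. shortest_path G x v p \<and> set p \<inter> S = {}}"
  have SV: "S \<subseteq> verts G - {x}"
    using S by (simp add: visibility_set_def)
  have disj: "D \<inter> S = {}"
    unfolding D_def by (auto simp: shortest_path_def path_between_def) (metis disjoint_iff last_in_set)
  have x_D: "x \<in> D"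
    using shortest_path_self[OF x] SV by (force simp: D_def)
  have "\<exists>u. {u, v} \<in> edges G \<and> gdist G x v = Suc (gdist G x u) \<and> (v \<in> D \<union> S \<longrightarrow> u \<in> D)"
    if v: "v \<in> verts G - {x}" for v
  proof -
    \<comment> \<open>For \<open>v\<close> in \<open>D\<close> or \<open>S\<close>, the path is
      chosen to meet \<open>S\<close> at most in \<open>v\<close>, so deleting its last vertex
      leaves a path witnessing \<open>last q \<in> D\<close>. For other vertices any shortest path
      will do.\<close>
    obtain p where p: "shortest_path G x v p" "v \<in> D \<union> S \<Longrightarrow> set p \<inter> S \<subseteq> {v}"
    proof (cases "v \<in> D \<union> S")
      case True
      then show ?thesis
        using that S unfolding D_def visibility_set_def by blast
    next
      case False
      then show ?thesis
        using that G(2) x v ex_shortest_path unfolding connected_graph_def by (metis DiffD1)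
    qed
    obtain q where q: "p = q @ [v]" "shortest_path G x (last q) q" "{last q, v} \<in> edges G"
      "v \<notin> set q" "gdist G x v = Suc (gdist G x (last q))"
      using shortest_path_snocD[OF p(1)] v by blast
    moreover have "v \<in> D \<union> S \<longrightarrow> last q \<in> D"
      using p(2) q unfolding D_def by fastforce
    ultimately show ?thesis
      by blast
  qed
  then obtain par0 where par0: "\<And>v. v \<in> verts G - {x} \<Longrightarrow>
      {par0 v, v} \<in> edges G \<and> gdist G x v = Suc (gdist G x (par0 v)) \<and> (v \<in> D \<union> S \<longrightarrow> par0 v \<in> D)"
    by metis
  \<comment> \<open>The choice says nothing about the root; making it a fixed point keeps iterated
    parents inside \<open>D\<close>, which contains \<open>x\<close>.\<close>
  define par where "par = par0(x := x)"
  interpret bfs_parents G x par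
    using G(1) x par0 by unfold_locales (auto simp: par_def)
  have D_verts: "D \<subseteq> verts G"
    unfolding D_def by (auto simp: shortest_path_def path_between_def)
  have "card S \<le> card (leaves T x)"
    using SV disj x_D par0 D_verts by (intro card_le_leaves[of S D]) (auto simp: par_def)
  with shortest_path_tree_T show thesis
    using that by blast
qed

theorem theorem2p2:
  fixes G :: "'a ugraph"
  assumes "simple_graph G" and "connected_graph G"
  shows "vv G = Max {card (leaves T x) | T x. shortest_path_tree G x T}"
proof (rule antisym)
  let ?L = "{card (leaves T x) | T x. shortest_path_tree G x T}"
  have "vv G \<in> {visibility_number G x | x. x \<in> verts G}"
    unfolding vv_def
    using finite_visibility_numbers visibility_numbers_nonempty assms by (intro Max_in) auto
  then obtain x where x: "x \<in> verts G" "vv G = visibility_number G x"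
    by blast
  have "visibility_number G x \<in> {card S | S. visibility_set G x S}"
    unfolding visibility_number_def
    using finite_visibility_cards[OF assms(1)] visibility_cards_nonempty by (rule Max_in)
  then obtain S where S: "visibility_set G x S" "visibility_number G x = card S"
    by blast
  obtain T where T: "shortest_path_tree G x T" "card S \<le> card (leaves T x)"
    using ex_tree_card_le_leaves[OF assms x(1) S(1)] .
  have "card (leaves T x) \<le> Max ?L"
    using finite_leaf_counts[OF assms(1)] T(1) by (intro Max_ge) auto
  with x S T show "vv G \<le> Max ?L"
    by simp
  \<comment> \<open>The tree \<open>T\<close> from the first inequality also shows that
    \<open>?L\<close> is nonempty.\<close>
  have "Max ?L \<in> ?L"
    using finite_leaf_counts[OF assms(1)] T(1) by (intro Max_in) auto
  then obtain T' y where T': "shortest_path_tree G y T'" "Max ?L = card (leaves T' y)"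
    by blast
  have "card (leaves T' y) \<le> visibility_number G y"
    unfolding visibility_number_def
    using finite_visibility_cards[OF assms(1)] visibility_set_leaves[OF T'(1)]
    by (intro Max_ge) auto
  also have "\<dots> \<le> vv G"
    unfolding vv_def
    using finite_visibility_numbers[OF assms(1)] T'(1)
    by (intro Max_ge) (auto simp: shortest_path_tree_def)
  finally show "Max ?L \<le> vv G"
    using T'(2) by simp
qed

end
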